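(* Let $G_1=(\tilde S_1,\tilde C_1,\tilde\Omega_1)$ and $G_2=(\tilde S_2,\tilde C_2,\tilde\Omega_2)$ be systems in $\mathcal{L}^{\mathrm{Bog.}}(n,m)$ (on a common set of $m$ modes). Then the series (cascade) connection $G_2\triangleleft G_1$, obtained in the zero-delay limit by passing the output of $G_1$ into the input of $G_2$, is the system in $\mathcal{L}^{\mathrm{Bog.}}(n,m)$ with parameters $$G_2\triangleleft G_1=\big(\tilde S_2\tilde S_1,\ \tilde C_2+\tilde S_2\tilde C_1,\ \tilde\Omega_1+\tilde\Omega_2+\mathrm{Im}_\flat\{\tilde C_2^\flat\tilde S_2\tilde C_1\}\big).$$ That is, this triple belongs to $\mathcal{L}^{\mathrm{Bog.}}(n,m)$, and, with $\tilde A=-\frac12\tilde C_1^\flat\tilde C_1-\frac12\tilde C_2^\flat\tilde C_2-i(\tilde\Omega_1+\tilde\Omega_2)$, imposing the constraint $\breve b_2=\breve b_{\mathrm{out},1}$ on the joint equations $$\dot{\breve a}=\tilde A\breve a-\tilde C_1^\flat\tilde S_1\breve b_1-\tilde C_2^\flat\tilde S_2\breve b_2,\qquad \breve b_{\mathrm{out},j}=\tilde C_j\breve a+\tilde S_j\breve b_j\quad(j=1,2)$$ yields the equations of the system $G_2\triangleleft G_1$ with input $\breve b_1$ and output $\breve b_{\mathrm{out},2}$, namely $$\dot{\breve a}=(\tilde A-\tilde C_2^\flat\tilde S_2\tilde C_1)\breve a-(\tilde C_2^\flat\tilde S_2+\tilde C_1^\flat)\tilde S_1\breve b_1,\qquad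 \breve b_{\mathrm{out},2}=(\tilde C_2+\tilde S_2\tilde C_1)\breve a+\tilde S_2\tilde S_1\breve b_1 .$$
   Context: For a complex matrix $X$, $X^\#$ is the entrywise complex conjugate and $X^\dagger$ the conjugate transpose. For $E_-,E_+\in\mathbb{C}^{r\times k}$, the doubled-up matrix is $$\Delta(E_-,E_+)=\begin{bmatrix} E_- & E_+ \\ E_+^\# & E_-^\# \end{bmatrix}\in\mathbb{C}^{2r\times2k}.$$ Let $J_n=\begin{bmatrix} I_n & 0 \\ 0 & -I_n \end{bmatrix}$; for a $2n\times2m$ matrix $X$ put $X^\flat=J_mX^\dagger J_n$, and for a square matrix $X$ of even size put $\mathrm{Im}_\flat X=\frac1{2i}(X-X^\flat)$. $\mathrm{Sp}(\mathbb{C}^n)$ is the group of $2n\times2n$ matrices $\tilde S$ of doubled-up form $\Delta(S_-,S_+)$ with $\tilde S^\flat\tilde S=\tilde S\tilde S^\flat=I$. $\mathcal{L}^{\mathrm{Bog.}}(n,m)$ is the class of linear quantum systems with $m$ oscillator modes and $n$ field channels; a system is given by a triple $(\tilde S,\tilde C,\tilde\Omega)$ with $\tilde S\in\mathrm{Sp}(\mathbb{C}^n)$, $\tilde C=\Delta(C_-,C_+)$ for some $C_\pm\in\mathbb{C}^{n\times m}$, and $\tilde\Omega\in\mathbb{C}^{2m\times2m}$ such that $-i\tilde\Omega$ is of doubled-up form and $\tilde\Omega^\flat=\tilde\Omega$. It is described by the linear equations $$\dot{\breve a}=\big(-\tfrac12\tilde C^\flat\tilde C-i\tilde\Omega\big)\breve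 a-\tilde C^\flat\tilde S\,\breve b,\qquad \breve b_{\mathrm{out}}=\tilde C\breve a+\tilde S\breve b,$$ where $\breve x=\begin{bmatrix} x \\ x^\# \end{bmatrix}$ denotes the doubled-up vector of mode operators $a$ (length $m$), input fields $b$ or output fields $b_{\mathrm{out}}$ (length $n$); the relations are used here purely algebraically. Two systems whose modes differ or partly overlap are regarded as systems on a common set of modes by padding $C_\pm$ and the blocks of $\tilde\Omega$ with zeros. *)

theory Defs
  imports "HOL.Vector_Spaces" "Jordan_Normal_Form.Schur_Decomposition"
begin

section \<open>Doubled-up matrices and the \<open>\<flat>\<close>-involution\<close>

abbreviation mat_conj :: "complex mat \<Rightarrow> complex mat" where
  "mat_conj X \<equiv> map_mat cnj X"

definition Delta :: "complex mat \<Rightarrow> complex mat \<Rightarrow> complex mat" where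
  "Delta Em Ep = four_block_mat Em Ep (mat_conj Ep) (mat_conj Em)"

definition doubled_up :: "nat \<Rightarrow> nat \<Rightarrow> complex mat \<Rightarrow> bool" where
  "doubled_up r k X \<longleftrightarrow>
     (\<exists>Em \<in> carrier_mat r k. \<exists>Ep \<in> carrier_mat r k. X = Delta Em Ep)"

definition J_mat :: "nat \<Rightarrow> complex mat" where
  "J_mat n = four_block_mat (1\<^sub>m n) (0\<^sub>m n n) (0\<^sub>m n n) (- 1\<^sub>m n)"

text \<open>The two sizes are read off from \<open>X\<close>, which is meant to be \<open>2n \<times> 2m\<close>.\<close>

definition flat :: "complex mat \<Rightarrow> complex mat" (\<open>(_\<^sup>\<flat>)\<close> [1000] 999) where
  "X\<^sup>\<flat> = J_mat (dim_col X div 2) * mat_adjoint X * J_mat (dim_row X div 2)"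

definition Im_flat :: "complex mat \<Rightarrow> complex mat" where
  "Im_flat X = (1 / (2 * \<i>)) \<cdot>\<^sub>m (X - X\<^sup>\<flat>)"

definition Sp :: "nat \<Rightarrow> complex mat set" where
  "Sp n = {S. doubled_up n n S \<and> S\<^sup>\<flat> * S = 1\<^sub>m (2 * n) \<and> S * S\<^sup>\<flat> = 1\<^sub>m (2 * n)}"


section \<open>Linear quantum systems\<close>

type_synonym system = "complex mat \<times> complex mat \<times> complex mat"

definition L_Bog :: "nat \<Rightarrow> nat \<Rightarrow> system set" where
  "L_Bog n m = {(S, C, \<Omega>).
     S \<in> Sp n \<and> doubled_up n m C \<and>
     \<Omega> \<in> carrier_mat (2 * m) (2 * m) \<and> doubled_up m m ((- \<i>) \<cdot>\<^sub>m \<Omega>) \<and> \<Omega>\<^sup>\<flat> = \<Omega>}"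

text \<open>
  Mode operators and fields are elements of a complex vector space with a conjugate-linear
  involution (the operator adjoint), for instance a complex *-algebra of operators. The products of
  operators play no role in the linear equations below. For a vector \<open>x\<close> of operators,
  \<open>x\<^sup>#\<close> is the entrywise adjoint.
\<close>

locale star_space = vector_space scale
  for scale :: "complex \<Rightarrow> 'v::ab_group_add \<Rightarrow> 'v" +
  fixes star :: "'v \<Rightarrow> 'v"
  assumes star_add: "star (x + y) = star x + star y"
    and star_scale: "star (scale c x) = scale (cnj c) (star x)"
    and star_star: "star (star x) = x"

definition breve :: "('v \<Rightarrow> 'v) \<Rightarrow> 'v vec \<Rightarrow> 'v vec" where
  "breve star x = x @\<^sub>v map_vec star x"

text \<open>The product of a complex matrix and a vector of operators.\<close>

definition act :: "(complex \<Rightarrow> 'v \<Rightarrow> 'v) \<Rightarrow> complex mat \<Rightarrow> 'v::ab_group_add vec \<Rightarrow> 'v vec" where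
  "act scale X x = vec (dim_row X) (\<lambda>i. \<Sum>j<dim_col X. scale (X $$ (i, j)) (x $ j))"

text \<open>
  In the following equations \<open>a'\<close> stands for the time derivative of \<open>a\<close>; since the relations are
  used purely algebraically, it is simply a further vector of operators. The derivative of
  \<open>breve a\<close> is \<open>breve a'\<close>.
\<close>

definition system_eqs ::
  "(complex \<Rightarrow> 'v \<Rightarrow> 'v) \<Rightarrow> ('v \<Rightarrow> 'v) \<Rightarrow> system \<Rightarrow>
   'v::ab_group_add vec \<Rightarrow> 'v vec \<Rightarrow> 'v vec \<Rightarrow> 'v vec \<Rightarrow> bool" where
  "system_eqs scale star G a' a b b_out = (case G of (S, C, \<Omega>) \<Rightarrow>
     breve star a' = act scale ((- 1/2) \<cdot>\<^sub>m (C\<^sup>\<flat> * C) - \<i> \<cdot>\<^sub>m \<Omega>) (breve star a)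
                     - act scale (C\<^sup>\<flat> * S) (breve star b) \<and>
     breve star b_out = act scale C (breve star a) + act scale S (breve star b))"

definition joint_drift :: "system \<Rightarrow> system \<Rightarrow> complex mat" where
  "joint_drift G1 G2 = (case (G1, G2) of ((S1, C1, \<Omega>1), (S2, C2, \<Omega>2)) \<Rightarrow>
     (- 1/2) \<cdot>\<^sub>m (C1\<^sup>\<flat> * C1) - (1/2) \<cdot>\<^sub>m (C2\<^sup>\<flat> * C2) - \<i> \<cdot>\<^sub>m (\<Omega>1 + \<Omega>2))"

text \<open>Two systems on the same modes, each with its own input and output, not yet connected.\<close>

definition joint_eqs ::
  "(complex \<Rightarrow> 'v \<Rightarrow> 'v) \<Rightarrow> ('v \<Rightarrow> 'v) \<Rightarrow> system \<Rightarrow> system \<Rightarrow>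
   'v::ab_group_add vec \<Rightarrow> 'v vec \<Rightarrow> 'v vec \<Rightarrow> 'v vec \<Rightarrow> 'v vec \<Rightarrow> 'v vec \<Rightarrow> bool" where
  "joint_eqs scale star G1 G2 a' a b1 b2 b_out1 b_out2 =
     (case (G1, G2) of ((S1, C1, \<Omega>1), (S2, C2, \<Omega>2)) \<Rightarrow>
     breve star a' = act scale (joint_drift G1 G2) (breve star a)
                     - act scale (C1\<^sup>\<flat> * S1) (breve star b1)
                     - act scale (C2\<^sup>\<flat> * S2) (breve star b2) \<and>
     breve star b_out1 = act scale C1 (breve star a) + act scale S1 (breve star b1) \<and>
     breve star b_out2 = act scale C2 (breve star a) + act scale S2 (breve star b2))"

text \<open>
  Input \<open>b1\<close> and output \<open>b_out2\<close> remain external; the internal fields \<open>b2\<close> and \<open>b_out1\<close> are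
  identified (zero delay) and eliminated.
\<close>

definition series_eqs ::
  "(complex \<Rightarrow> 'v \<Rightarrow> 'v) \<Rightarrow> ('v \<Rightarrow> 'v) \<Rightarrow> nat \<Rightarrow> system \<Rightarrow> system \<Rightarrow>
   'v::ab_group_add vec \<Rightarrow> 'v vec \<Rightarrow> 'v vec \<Rightarrow> 'v vec \<Rightarrow> bool" where
  "series_eqs scale star n G2 G1 a' a b1 b_out2 =
     (\<exists>b2 \<in> carrier_vec n. \<exists>b_out1 \<in> carrier_vec n.
        joint_eqs scale star G1 G2 a' a b1 b2 b_out1 b_out2 \<and>
        breve star b2 = breve star b_out1)"

end

(* In (C2 + S2 C1)^b (C2 + S2 C1), where ^b is the flat involution, unitarity S2^b S2 = 1 reduces
   the last term to C1^b C1. The cross terms are X and X^b with X = C2^b S2 C1; as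
   -i Im_b X = -(X - X^b)/2, the new Hamiltonian term turns -(X + X^b)/2 into the drift
   correction -X.
   Conversely, every solution of the reduced equations arises from internal fields: doubled-up
   matrices map doubled-up vectors of operators to doubled-up ones, so C1 a + S1 b1 is again of
   the form breve b_out1. *)
theory Submission
  imports Defs
begin

section \<open>The \<open>\<flat>\<close>-involution\<close>

text \<open>The diagonal of \<open>J_mat n\<close>. With it the identities of the involution become
  identities of signs, all resting on a sign squaring to 1.\<close>

definition J_sign :: "nat \<Rightarrow> nat \<Rightarrow> complex" where
  "J_sign n i = (if i < n then 1 else - 1)"

lemma J_sign_mult_self [simp]: "J_sign n i * J_sign n i = 1"
  by (simp add: J_sign_def)

lemma cnj_J_sign [simp]: "cnj (J_sign n i) = J_sign n i"
  by (simp add: J_sign_def)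

lemma J_mat_carrier [simp]: "J_mat n \<in> carrier_mat (2 * n) (2 * n)"
  using four_block_carrier_mat[of "1\<^sub>m n" n n "- 1\<^sub>m n" n n "0\<^sub>m n n" "0\<^sub>m n n"]
  by (simp add: J_mat_def mult_2)

lemma J_mat_index:
  assumes "i < 2 * n" "j < 2 * n"
  shows "J_mat n $$ (i, j) = (if i = j then J_sign n i else 0)"
  using assms by (auto simp: J_mat_def J_sign_def)

lemma index_mult_mat_sum:
  fixes X Y :: "'a::semiring_0 mat"
  assumes "X \<in> carrier_mat r k" "Y \<in> carrier_mat k c" "i < r" "j < c"
  shows "(X * Y) $$ (i, j) = (\<Sum>l<k. X $$ (i, l) * Y $$ (l, j))"
  using assms by (auto simp: scalar_prod_def atLeast0LessThan intro!: sum.cong)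

lemma J_mat_mult_index:
  assumes "X \<in> carrier_mat (2 * n) c" "i < 2 * n" "j < c"
  shows "(J_mat n * X) $$ (i, j) = J_sign n i * X $$ (i, j)"
proof -
  have "(J_mat n * X) $$ (i, j) = (\<Sum>l<2 * n. J_mat n $$ (i, l) * X $$ (l, j))"
    using assms by (intro index_mult_mat_sum) auto
  also have "\<dots> = (\<Sum>l<2 * n. if i = l then J_sign n i * X $$ (l, j) else 0)"
    using assms by (intro sum.cong) (auto simp: J_mat_index)
  also have "\<dots> = J_sign n i * X $$ (i, j)"
    using assms by simp
  finally show ?thesis .
qed

lemma mult_J_mat_index:
  assumes "X \<in> carrier_mat r (2 * n)" "i < r" "j < 2 * n"
  shows "(X * J_mat n) $$ (i, j) = X $$ (i, j) * J_sign n j"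
proof -
  have "(X * J_mat n) $$ (i, j) = (\<Sum>l<2 * n. X $$ (i, l) * J_mat n $$ (l, j))"
    using assms by (intro index_mult_mat_sum) auto
  also have "\<dots> = (\<Sum>l<2 * n. if j = l then X $$ (i, l) * J_sign n l else 0)"
    using assms by (intro sum.cong) (auto simp: J_mat_index)
  also have "\<dots> = X $$ (i, j) * J_sign n j"
    using assms by simp
  finally show ?thesis .
qed

lemma mat_adjoint_carrier:
  "X \<in> carrier_mat r c \<Longrightarrow> mat_adjoint X \<in> carrier_mat c r"
  by (intro carrier_matI) (auto simp: mat_adjoint_def)

lemma mat_adjoint_index:
  fixes X :: "complex mat"
  assumes "i < dim_col X" "j < dim_row X"
  shows "mat_adjoint X $$ (i, j) = cnj (X $$ (j, i))"
  using assms by (simp add: mat_adjoint_def mat_of_rows_def)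

lemma flat_carrier:
  assumes "X \<in> carrier_mat (2 * r) (2 * c)"
  shows "X\<^sup>\<flat> \<in> carrier_mat (2 * c) (2 * r)"
  using assms mat_adjoint_carrier[OF assms]
  by (auto simp: flat_def intro!: mult_carrier_mat)

text \<open>Both factors \<open>J_mat\<close> are diagonal, so they only scale the rows and columns
  of the adjoint. The rules for products, sums, scalars and iteration of the involution are read off
  from this entry formula.\<close>

lemma flat_index:
  assumes X: "X \<in> carrier_mat (2 * r) (2 * c)" and "i < 2 * c" "j < 2 * r"
  shows "X\<^sup>\<flat> $$ (i, j) = J_sign c i * J_sign r j * cnj (X $$ (j, i))"
proof -
  note X' = mat_adjoint_carrier[OF X]
  have "X\<^sup>\<flat> = J_mat c * mat_adjoint X * J_mat r"
    using X by (simp add: flat_def)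
  then have "X\<^sup>\<flat> $$ (i, j) = (J_mat c * mat_adjoint X) $$ (i, j) * J_sign r j"
    using assms mult_carrier_mat[OF J_mat_carrier X'] by (simp add: mult_J_mat_index)
  then show ?thesis
    using assms X' by (simp add: J_mat_mult_index mat_adjoint_index)
qed

lemma flat_mult:
  assumes X: "X \<in> carrier_mat (2 * r) (2 * k)" and Y: "Y \<in> carrier_mat (2 * k) (2 * c)"
  shows "(X * Y)\<^sup>\<flat> = Y\<^sup>\<flat> * X\<^sup>\<flat>"
proof (rule eq_matI)
  note XY = mult_carrier_mat[OF X Y] and fX = flat_carrier[OF X] and fY = flat_carrier[OF Y]
  show "dim_row ((X * Y)\<^sup>\<flat>) = dim_row (Y\<^sup>\<flat> * X\<^sup>\<flat>)" "dim_col ((X * Y)\<^sup>\<flat>) = dim_col (Y\<^sup>\<flat> * X\<^sup>\<flat>)"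
    using flat_carrier[OF XY] fX fY by auto
  fix i j assume "i < dim_row (Y\<^sup>\<flat> * X\<^sup>\<flat>)" "j < dim_col (Y\<^sup>\<flat> * X\<^sup>\<flat>)"
  then have ij: "i < 2 * c" "j < 2 * r" using fX fY by auto
  have "(X * Y)\<^sup>\<flat> $$ (i, j) =
      (\<Sum>l<2 * k. J_sign c i * J_sign r j * (cnj (X $$ (j, l)) * cnj (Y $$ (l, i))))"
    by (simp only: flat_index[OF XY ij] index_mult_mat_sum[OF X Y ij(2,1)] cnj_sum
        complex_cnj_mult sum_distrib_left)
  also have "\<dots> = (\<Sum>l<2 * k. Y\<^sup>\<flat> $$ (i, l) * X\<^sup>\<flat> $$ (l, j))"
  proof (rule sum.cong[OF refl])
    fix l assume "l \<in> {..<2 * k}"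
    \<comment> \<open>The sign of the summation index \<open>l\<close> comes once from each factor
      and squares to 1; this is \<open>J_mat k * J_mat k = 1\<^sub>m (2 * k)\<close> in
      entries.\<close>
    then have "Y\<^sup>\<flat> $$ (i, l) * X\<^sup>\<flat> $$ (l, j) = (J_sign k l * J_sign k l) *
        (J_sign c i * J_sign r j * (cnj (X $$ (j, l)) * cnj (Y $$ (l, i))))"
      using ij by (simp only: flat_index[OF X] flat_index[OF Y] lessThan_iff mult_ac)
    then show "J_sign c i * J_sign r j * (cnj (X $$ (j, l)) * cnj (Y $$ (l, i))) =
        Y\<^sup>\<flat> $$ (i, l) * X\<^sup>\<flat> $$ (l, j)" by simp
  qed
  also have "\<dots> = (Y\<^sup>\<flat> * X\<^sup>\<flat>) $$ (i, j)"
    by (rule index_mult_mat_sum[OF fY fX ij, symmetric])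
  finally show "(X * Y)\<^sup>\<flat> $$ (i, j) = (Y\<^sup>\<flat> * X\<^sup>\<flat>) $$ (i, j)" .
qed

lemma flat_add:
  assumes X: "X \<in> carrier_mat (2 * r) (2 * c)" and Y: "Y \<in> carrier_mat (2 * r) (2 * c)"
  shows "(X + Y)\<^sup>\<flat> = X\<^sup>\<flat> + Y\<^sup>\<flat>"
  using X Y flat_carrier[OF X] flat_carrier[OF Y] flat_carrier[OF add_carrier_mat[OF Y, of X]]
  by (intro eq_matI) (auto simp: flat_index[of _ r c] algebra_simps)

lemma flat_smult:
  assumes X: "X \<in> carrier_mat (2 * r) (2 * c)"
  shows "(z \<cdot>\<^sub>m X)\<^sup>\<flat> = cnj z \<cdot>\<^sub>m X\<^sup>\<flat>"
  using X flat_carrier[OF X] flat_carrier[OF smult_carrier_mat[OF X, of z]]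
  by (intro eq_matI) (auto simp: flat_index[of _ r c])

lemma flat_flat:
  assumes X: "X \<in> carrier_mat (2 * r) (2 * c)"
  shows "(X\<^sup>\<flat>)\<^sup>\<flat> = X"
proof -
  note fX = flat_carrier[OF X]
  have "(X\<^sup>\<flat>)\<^sup>\<flat> $$ (i, j) = X $$ (i, j)" if "i < 2 * r" "j < 2 * c" for i j
  proof -
    have "(X\<^sup>\<flat>)\<^sup>\<flat> $$ (i, j) =
        (J_sign r i * J_sign r i) * (J_sign c j * J_sign c j) * X $$ (i, j)"
      using that by (simp only: flat_index[OF fX] flat_index[OF X] complex_cnj_mult
          cnj_J_sign complex_cnj_cnj mult_ac)
    then show ?thesis by simp
  qed
  then show ?thesis
    using X flat_carrier[OF fX] by (intro eq_matI) auto
qed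

lemma Im_flat_carrier:
  assumes X: "X \<in> carrier_mat (2 * r) (2 * r)"
  shows "Im_flat X \<in> carrier_mat (2 * r) (2 * r)"
  using X flat_carrier[OF X] by (simp add: Im_flat_def minus_carrier_mat)

text \<open>Two sign changes cancel: the scalar 1/(2i) is negated by conjugation, and the difference
  is negated because the involution swaps \<open>X\<close> and
  \<open>X\<^sup>\<flat>\<close>.\<close>

lemma flat_Im_flat:
  assumes X: "X \<in> carrier_mat (2 * r) (2 * r)"
  shows "(Im_flat X)\<^sup>\<flat> = Im_flat X"
proof -
  note fX = flat_carrier[OF X]
  have *: "X - X\<^sup>\<flat> = X + (- 1) \<cdot>\<^sub>m X\<^sup>\<flat>" using X fX by (intro eq_matI) auto
  have "(Im_flat X)\<^sup>\<flat> = cnj (1 / (2 * \<i>)) \<cdot>\<^sub>m (X\<^sup>\<flat> + (- 1) \<cdot>\<^sub>m X)"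
    using X fX by (simp add: Im_flat_def * flat_smult[of _ r r] flat_add[of _ r r] flat_flat)
  also have "\<dots> = Im_flat X"
    using X fX by (intro eq_matI) (auto simp: Im_flat_def field_simps)
  finally show ?thesis .
qed


section \<open>Doubled-up matrices\<close>

lemma doubled_up_Delta:
  "Em \<in> carrier_mat r k \<Longrightarrow> Ep \<in> carrier_mat r k \<Longrightarrow> doubled_up r k (Delta Em Ep)"
  by (auto simp: doubled_up_def)

lemma doubled_upE:
  assumes "doubled_up r k X"
  obtains Em Ep where "Em \<in> carrier_mat r k" "Ep \<in> carrier_mat r k" "X = Delta Em Ep"
  using assms by (auto simp: doubled_up_def)

lemma doubled_up_carrier:
  assumes "doubled_up r k X"
  shows "X \<in> carrier_mat (2 * r) (2 * k)"
  using assms by (auto simp: doubled_up_def Delta_def intro!: carrier_matI)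

lemma doubled_up_add:
  assumes "doubled_up r k X" "doubled_up r k Y"
  shows "doubled_up r k (X + Y)"
proof -
  obtain A B where A: "A \<in> carrier_mat r k" "B \<in> carrier_mat r k" "X = Delta A B"
    using assms(1) by (rule doubled_upE)
  obtain D E where D: "D \<in> carrier_mat r k" "E \<in> carrier_mat r k" "Y = Delta D E"
    using assms(2) by (rule doubled_upE)
  have "X + Y = Delta (A + D) (B + E)"
    using A D by (intro eq_matI) (auto simp: Delta_def)
  then show ?thesis using A D by (simp add: doubled_up_Delta)
qed

text \<open>The lower blocks are conjugates of the upper ones, so a factor can be moved into
  \<open>Delta\<close> when it equals its own conjugate.\<close>

lemma doubled_up_smult_real:
  assumes "doubled_up r k X" "z \<in> \<real>"
  shows "doubled_up r k (z \<cdot>\<^sub>m X)"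
proof -
  obtain A B where A: "A \<in> carrier_mat r k" "B \<in> carrier_mat r k" "X = Delta A B"
    using assms(1) by (rule doubled_upE)
  have "z \<cdot>\<^sub>m X = Delta (z \<cdot>\<^sub>m A) (z \<cdot>\<^sub>m B)"
    using A assms(2) by (intro eq_matI) (auto simp: Delta_def Reals_cnj_iff)
  then show ?thesis using A by (simp add: doubled_up_Delta)
qed

lemma mat_conj_mult:
  assumes "X \<in> carrier_mat r k" "Y \<in> carrier_mat k c"
  shows "mat_conj (X * Y) = mat_conj X * mat_conj Y"
  using assms by (intro eq_matI) (auto simp: scalar_prod_def)

lemma mat_conj_add:
  assumes "X \<in> carrier_mat r k" "Y \<in> carrier_mat r k"
  shows "mat_conj (X + Y) = mat_conj X + mat_conj Y"
  using assms by (intro eq_matI) auto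

lemma mat_conj_mat_conj: "mat_conj (mat_conj X) = X"
  by (intro eq_matI) auto

lemma doubled_up_mult:
  assumes "doubled_up r k X" "doubled_up k c Y"
  shows "doubled_up r c (X * Y)"
proof -
  obtain A B where A: "A \<in> carrier_mat r k" "B \<in> carrier_mat r k" "X = Delta A B"
    using assms(1) by (rule doubled_upE)
  obtain D E where D: "D \<in> carrier_mat k c" "E \<in> carrier_mat k c" "Y = Delta D E"
    using assms(2) by (rule doubled_upE)
  \<comment> \<open>The upper blocks of the block product.\<close>
  let ?M = "A * D + B * mat_conj E" and ?P = "A * E + B * mat_conj D"
  \<comment> \<open>The summands are put in the order in which the lower blocks of the block product
    list them.\<close>
  have cm: "mat_conj ?M = mat_conj B * E + mat_conj A * mat_conj D"
    "mat_conj ?P = mat_conj B * D + mat_conj A * mat_conj E"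
    using A D
    by (simp_all add: mat_conj_add[of _ r c] mat_conj_mult[of _ r k _ c] mat_conj_mat_conj
        comm_add_mat[of _ r c])
  have "X * Y = Delta ?M ?P"
    unfolding A(3) D(3) Delta_def cm using A D by (intro mult_four_block_mat) auto
  then show ?thesis using A D by (simp add: doubled_up_Delta)
qed

lemma doubled_up_flat:
  assumes "doubled_up r k X"
  shows "doubled_up k r (X\<^sup>\<flat>)"
proof -
  obtain A B where A: "A \<in> carrier_mat r k" "B \<in> carrier_mat r k" "X = Delta A B"
    using assms(1) by (rule doubled_upE)
  note X = doubled_up_carrier[OF assms]
  \<comment> \<open>The adjoint of \<open>Delta A B\<close> has upper blocks
    \<open>mat_adjoint A\<close> and \<open>transpose_mat B\<close>; the outer \<open>J_mat\<close>
    factors negate the off-diagonal blocks.\<close>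
  have "X\<^sup>\<flat> = Delta (transpose_mat (mat_conj A)) (- transpose_mat B)" (is "_ = ?R")
  proof (rule eq_matI)
    show "dim_row (X\<^sup>\<flat>) = dim_row ?R" "dim_col (X\<^sup>\<flat>) = dim_col ?R"
      using A flat_carrier[OF X] by (auto simp: Delta_def)
    fix i j assume "i < dim_row ?R" "j < dim_col ?R"
    then have ij: "i < k + k" "j < r + r" using A by (auto simp: Delta_def)
    then have "X\<^sup>\<flat> $$ (i, j) = J_sign k i * J_sign r j * cnj (X $$ (j, i))"
      by (intro flat_index[OF X]) auto
    then show "X\<^sup>\<flat> $$ (i, j) = ?R $$ (i, j)"
      using A ij by (auto simp: Delta_def J_sign_def)
  qed
  then show ?thesis using A by (simp add: doubled_up_Delta)
qed

text \<open>The scalar -i/(2i) is real, which leaves a real combination of two doubled-up matrices.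
  This makes the interaction term of the series connection an admissible Hamiltonian.\<close>

lemma doubled_up_Im_flat:
  assumes X: "doubled_up r r X"
  shows "doubled_up r r ((- \<i>) \<cdot>\<^sub>m Im_flat X)"
proof -
  note cX = doubled_up_carrier[OF X]
  have "(- \<i>) \<cdot>\<^sub>m Im_flat X = (- 1 / 2) \<cdot>\<^sub>m X + (1 / 2) \<cdot>\<^sub>m X\<^sup>\<flat>"
    using cX flat_carrier[OF cX] by (intro eq_matI) (auto simp: Im_flat_def field_simps)
  moreover have "doubled_up r r ((- 1 / 2) \<cdot>\<^sub>m X + (1 / 2) \<cdot>\<^sub>m X\<^sup>\<flat>)"
    using X by (intro doubled_up_add doubled_up_smult_real doubled_up_flat) auto
  ultimately show ?thesis by simp
qed

lemma doubled_up_index: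
  assumes "doubled_up r k X" "i < r" "j < k"
  shows "X $$ (r + i, j) = cnj (X $$ (i, k + j))"
    "X $$ (r + i, k + j) = cnj (X $$ (i, j))"
  using assms by (auto simp: doubled_up_def Delta_def)


section \<open>Matrices acting on vectors of operators\<close>

lemma act_carrier: "X \<in> carrier_mat r c \<Longrightarrow> act scale X x \<in> carrier_vec r"
  by (auto simp: act_def)

text \<open>Recovers a vector of operators from its doubled-up form by taking the upper
  half.\<close>

lemma breve_eqI:
  assumes "w \<in> carrier_vec (2 * n)" "\<And>i. i < n \<Longrightarrow> w $ (n + i) = star (w $ i)"
  shows "breve star (vec n (\<lambda>i. w $ i)) = w"
proof (rule eq_vecI)
  show "dim_vec (breve star (vec n (($) w))) = dim_vec w"
    using assms by (simp add: breve_def)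
  fix i assume "i < dim_vec w"
  then show "breve star (vec n (\<lambda>i. w $ i)) $ i = w $ i"
    \<comment> \<open>An index \<open>i\<close> of the lower half has offset \<open>i - n\<close>
      there.\<close>
    using assms(1) assms(2)[of "i - n"] by (auto simp: breve_def)
qed

context star_space
begin

lemma act_add_left:
  assumes "X \<in> carrier_mat r c" "Y \<in> carrier_mat r c"
  shows "act scale (X + Y) x = act scale X x + act scale Y x"
  using assms
  by (intro eq_vecI) (auto simp: act_def scale_left_distrib sum.distrib[symmetric] intro!: sum.cong)

lemma act_diff_left:
  assumes "X \<in> carrier_mat r c" "Y \<in> carrier_mat r c"
  shows "act scale (X - Y) x = act scale X x - act scale Y x"
  using assms
  by (intro eq_vecI) (auto simp: act_def scale_left_diff_distrib sum_subtractf[symmetric] intro!: sum.cong)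

lemma act_add_right:
  assumes "X \<in> carrier_mat r c" "x \<in> carrier_vec c" "y \<in> carrier_vec c"
  shows "act scale X (x + y) = act scale X x + act scale X y"
  using assms
  by (intro eq_vecI) (auto simp: act_def scale_right_distrib sum.distrib[symmetric] intro!: sum.cong)

text \<open>An exchange of the two finite sums. When an output is fed into an input, this turns the
  successive actions into matrix products.\<close>

lemma act_act:
  assumes X: "X \<in> carrier_mat r k" and Y: "Y \<in> carrier_mat k c"
  shows "act scale X (act scale Y x) = act scale (X * Y) x"
proof (rule eq_vecI)
  show "dim_vec (act scale X (act scale Y x)) = dim_vec (act scale (X * Y) x)"
    by (simp add: act_def)
  fix i assume "i < dim_vec (act scale (X * Y) x)"
  then have i: "i < r" using X by (simp add: act_def)
  have "act scale X (act scale Y x) $ i =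
      (\<Sum>l<k. \<Sum>j<c. scale (X $$ (i, l) * Y $$ (l, j)) (x $ j))"
    using X Y i by (auto simp: act_def scale_sum_right intro!: sum.cong)
  also have "\<dots> = (\<Sum>j<c. \<Sum>l<k. scale (X $$ (i, l) * Y $$ (l, j)) (x $ j))"
    by (rule sum.swap)
  also have "\<dots> = (\<Sum>j<c. scale ((X * Y) $$ (i, j)) (x $ j))"
    using i by (intro sum.cong) (auto simp del: index_mult_mat
        simp: index_mult_mat_sum[OF X Y] scale_sum_left)
  also have "\<dots> = act scale (X * Y) x $ i"
    using X Y i by (simp add: act_def)
  finally show "act scale X (act scale Y x) $ i = act scale (X * Y) x $ i" .
qed

lemma star_sum: "star (\<Sum>i\<in>I. f i) = (\<Sum>i\<in>I. star (f i))"
proof -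
  \<comment> \<open>Covers the empty index set and the infinite ones, over which a sum is 0 by
    convention.\<close>
  have "star 0 = 0" using star_add[of 0 0] by simp
  then show ?thesis by (induction I rule: infinite_finite_induct) (auto simp: star_add)
qed

text \<open>The map \<open>star\<close> conjugates the coefficients and exchanges the entries of
  \<open>x\<close> with their adjoints; passing from row \<open>i\<close> to row
  \<open>n + i\<close> of a doubled-up matrix conjugates the entries and exchanges the two column
  halves. The two effects agree.\<close>

lemma act_breve_conj:
  assumes X: "doubled_up n m X" and x: "x \<in> carrier_vec m" and i: "i < n"
  shows "act scale X (breve star x) $ (n + i) = star (act scale X (breve star x) $ i)"
proof -
  have split: "(\<Sum>j<2 * m. f j) = (\<Sum>j<m. f j) + (\<Sum>j<m. f (m + j))" for f :: "nat \<Rightarrow> 'v"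
  proof -
    \<comment> \<open>The length \<open>k\<close> of the second half is kept separate from
      \<open>m\<close>, so that the induction leaves the first half fixed.\<close>
    have "(\<Sum>j<m + k. f j) = (\<Sum>j<m. f j) + (\<Sum>j<k. f (m + j))" for k
      by (induction k) (auto simp: add_ac)
    then show ?thesis by (simp add: mult_2)
  qed
  let ?P = "\<Sum>j<m. scale (cnj (X $$ (i, m + j))) (x $ j)"
  let ?Q = "\<Sum>j<m. scale (cnj (X $$ (i, j))) (star (x $ j))"
  have "act scale X (breve star x) $ (n + i) = ?P + ?Q"
    using doubled_up_carrier[OF X] x i
    by (simp add: act_def breve_def split doubled_up_index[OF X])
  moreover have "star (act scale X (breve star x) $ i) = ?Q + ?P"
    using doubled_up_carrier[OF X] x i
    by (simp add: act_def breve_def split star_add star_sum star_scale star_star)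
  ultimately show ?thesis by (simp only: add.commute)
qed

text \<open>Supplies the internal field of the series connection: the right-hand side is an output
  equation, and its upper half is the required vector.\<close>

lemma breve_of_output:
  assumes X: "doubled_up n m X" and Y: "doubled_up n k Y"
    and x: "x \<in> carrier_vec m" and y: "y \<in> carrier_vec k"
  obtains z where "z \<in> carrier_vec n"
    "breve star z = act scale X (breve star x) + act scale Y (breve star y)"
proof
  let ?w = "act scale X (breve star x) + act scale Y (breve star y)"
  have d: "dim_vec (act scale X (breve star x)) = 2 * n" "dim_vec (act scale Y (breve star y)) = 2 * n"
    using doubled_up_carrier[OF X] doubled_up_carrier[OF Y] by (auto simp: act_def)
  show "vec n (\<lambda>i. ?w $ i) \<in> carrier_vec n" by simp
  show "breve star (vec n (\<lambda>i. ?w $ i)) = ?w"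
  proof (rule breve_eqI)
    show "?w \<in> carrier_vec (2 * n)" using d by (intro carrier_vecI) simp
    show "?w $ (n + i) = star (?w $ i)" if "i < n" for i
      using that d by (simp add: act_breve_conj[OF X x] act_breve_conj[OF Y y] star_add)
  qed
qed

end

section \<open>The series connection\<close>

lemma L_BogD:
  assumes "(S, C, \<Omega>) \<in> L_Bog n m"
  shows "doubled_up n n S" "S\<^sup>\<flat> * S = 1\<^sub>m (2 * n)" "S * S\<^sup>\<flat> = 1\<^sub>m (2 * n)" "doubled_up n m C"
    "\<Omega> \<in> carrier_mat (2 * m) (2 * m)" "doubled_up m m ((- \<i>) \<cdot>\<^sub>m \<Omega>)" "\<Omega>\<^sup>\<flat> = \<Omega>"
    "S \<in> carrier_mat (2 * n) (2 * n)" "C \<in> carrier_mat (2 * n) (2 * m)"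
    "S\<^sup>\<flat> \<in> carrier_mat (2 * n) (2 * n)" "C\<^sup>\<flat> \<in> carrier_mat (2 * m) (2 * n)"
  using assms doubled_up_carrier flat_carrier by (auto simp: L_Bog_def Sp_def)

text \<open>The form in which \<open>S\<^sup>\<flat> * S = 1\<^sub>m (2 * n)\<close> enters: in the
  middle of a product of four factors, as in
  \<open>(C1\<^sup>\<flat> * S2\<^sup>\<flat>) * (S2 * C1)\<close>.\<close>

lemma mult_mat_cancel_middle:
  fixes A B C D :: "'a::semiring_1 mat"
  assumes A: "A \<in> carrier_mat r k" and B: "B \<in> carrier_mat k l"
    and C: "C \<in> carrier_mat l k" and D: "D \<in> carrier_mat k c"
    and BC: "B * C = 1\<^sub>m k"
  shows "(A * B) * (C * D) = A * D"
proof -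
  have "(A * B) * (C * D) = A * (B * (C * D))"
    by (rule assoc_mult_mat[OF A B mult_carrier_mat[OF C D]])
  also have "B * (C * D) = (B * C) * D"
    by (rule assoc_mult_mat[OF B C D, symmetric])
  finally show ?thesis by (simp only: BC left_mult_one_mat[OF D])
qed

text \<open>The involution reverses products, so the two inner factors cancel first and then the two
  outer ones.\<close>

lemma Sp_mult:
  assumes "S1 \<in> Sp n" "S2 \<in> Sp n"
  shows "S2 * S1 \<in> Sp n"
proof -
  have d: "doubled_up n n S1" "doubled_up n n S2"
    and u: "S1\<^sup>\<flat> * S1 = 1\<^sub>m (2 * n)" "S1 * S1\<^sup>\<flat> = 1\<^sub>m (2 * n)"
      "S2\<^sup>\<flat> * S2 = 1\<^sub>m (2 * n)" "S2 * S2\<^sup>\<flat> = 1\<^sub>m (2 * n)"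
    using assms by (auto simp: Sp_def)
  note c = d[THEN doubled_up_carrier]
  note fc = c[THEN flat_carrier]
  have "S1\<^sup>\<flat> * S2\<^sup>\<flat> * (S2 * S1) = 1\<^sub>m (2 * n)" "S2 * S1 * (S1\<^sup>\<flat> * S2\<^sup>\<flat>) = 1\<^sub>m (2 * n)"
    using mult_mat_cancel_middle[OF fc(1,2) c(2,1) u(3)]
      mult_mat_cancel_middle[OF c(2,1) fc(1,2) u(2)] u by simp_all
  then show ?thesis
    using d by (simp add: Sp_def doubled_up_mult flat_mult[OF c(2,1)])
qed

section \<open>Matrix identities for the parameters of the series connection\<close>

context
  fixes n m :: nat and S1 C1 \<Omega>1 S2 C2 \<Omega>2 :: "complex mat"
  assumes G1: "(S1, C1, \<Omega>1) \<in> L_Bog n m"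
    and G2: "(S2, C2, \<Omega>2) \<in> L_Bog n m"
begin

lemmas [simp] = L_BogD(5,8-)[OF G1] L_BogD(5,8-)[OF G2]

lemma product_carriers [simp]:
  "S2 * S1 \<in> carrier_mat (2 * n) (2 * n)"
  "S2 * C1 \<in> carrier_mat (2 * n) (2 * m)"
  "C1\<^sup>\<flat> * C1 \<in> carrier_mat (2 * m) (2 * m)"
  "C2\<^sup>\<flat> * C2 \<in> carrier_mat (2 * m) (2 * m)"
  "C1\<^sup>\<flat> * S1 \<in> carrier_mat (2 * m) (2 * n)"
  "C2\<^sup>\<flat> * S2 \<in> carrier_mat (2 * m) (2 * n)"
  "C1\<^sup>\<flat> * S2\<^sup>\<flat> \<in> carrier_mat (2 * m) (2 * n)"
  "C2\<^sup>\<flat> * S2 * S1 \<in> carrier_mat (2 * m) (2 * n)"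
  by (rule mult_carrier_mat[of _ _ "2 * n"]; simp add: mult_carrier_mat[of _ _ "2 * n"])+

lemma coupling_carrier [simp]: "C2\<^sup>\<flat> * S2 * C1 \<in> carrier_mat (2 * m) (2 * m)"
  by (rule mult_carrier_mat[of _ _ "2 * n"]) simp_all

text \<open>Identifies the second cross term of the expansion in \<open>series_drift\<close> as the
  image of the first under the involution.\<close>

lemma flat_coupling: "(C2\<^sup>\<flat> * S2 * C1)\<^sup>\<flat> = C1\<^sup>\<flat> * (S2\<^sup>\<flat> * C2)"
proof -
  have "(C2\<^sup>\<flat> * S2 * C1)\<^sup>\<flat> = C1\<^sup>\<flat> * (C2\<^sup>\<flat> * S2)\<^sup>\<flat>"
    by (rule flat_mult[of _ m n _ m]) simp_all
  also have "(C2\<^sup>\<flat> * S2)\<^sup>\<flat> = S2\<^sup>\<flat> * (C2\<^sup>\<flat>)\<^sup>\<flat>"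
    by (rule flat_mult[of _ m n _ n]) simp_all
  finally show ?thesis by (simp add: flat_flat[of _ n m])
qed

lemma flat_series_C: "(C2 + S2 * C1)\<^sup>\<flat> = C2\<^sup>\<flat> + C1\<^sup>\<flat> * S2\<^sup>\<flat>"
  by (subst flat_add[of _ n m]) (simp_all add: flat_mult[of _ n n _ m])

text \<open>Each defining condition is closed under the operations used: \<open>Sp n\<close> under
  products, doubled-up form under sums and products, and both conditions on the Hamiltonian under
  sums. The new summand meets them by \<open>doubled_up_Im_flat\<close> and
  \<open>flat_Im_flat\<close>.\<close>

lemma series_in_L_Bog:
  "(S2 * S1, C2 + S2 * C1, \<Omega>1 + \<Omega>2 + Im_flat (C2\<^sup>\<flat> * S2 * C1)) \<in> L_Bog n m"
proof -
  let ?X = "C2\<^sup>\<flat> * S2 * C1"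
  note d1 = L_BogD[OF G1] and d2 = L_BogD[OF G2]
  note I [simp] = Im_flat_carrier[OF coupling_carrier]
  have dX: "doubled_up m m ?X"
    using d1 d2 by (intro doubled_up_mult[of m n] doubled_up_flat)
  have "(- \<i>) \<cdot>\<^sub>m (\<Omega>1 + \<Omega>2 + Im_flat ?X) =
      (- \<i>) \<cdot>\<^sub>m \<Omega>1 + (- \<i>) \<cdot>\<^sub>m \<Omega>2 + (- \<i>) \<cdot>\<^sub>m Im_flat ?X"
    by (simp add: add_smult_distrib_left_mat[of _ "2 * m" "2 * m"])
  moreover have "doubled_up m m ((- \<i>) \<cdot>\<^sub>m \<Omega>1 + (- \<i>) \<cdot>\<^sub>m \<Omega>2 + (- \<i>) \<cdot>\<^sub>m Im_flat ?X)"
    by (intro doubled_up_add doubled_up_Im_flat dX d1(6) d2(6))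
  moreover have "(\<Omega>1 + \<Omega>2 + Im_flat ?X)\<^sup>\<flat> = \<Omega>1 + \<Omega>2 + Im_flat ?X"
    by (simp add: flat_add[of _ m m] flat_Im_flat[of _ m] d1(7) d2(7))
  moreover have "doubled_up n m (C2 + S2 * C1)"
    using d1 d2 by (intro doubled_up_add doubled_up_mult[of n n])
  moreover have "S2 * S1 \<in> Sp n"
    using G1 G2 by (intro Sp_mult) (auto simp: L_Bog_def)
  ultimately show ?thesis by (simp add: L_Bog_def)
qed

lemma series_drift:
  "(- 1/2) \<cdot>\<^sub>m ((C2 + S2 * C1)\<^sup>\<flat> * (C2 + S2 * C1)) - \<i> \<cdot>\<^sub>m (\<Omega>1 + \<Omega>2 + Im_flat (C2\<^sup>\<flat> * S2 * C1))
    = joint_drift (S1, C1, \<Omega>1) (S2, C2, \<Omega>2) - C2\<^sup>\<flat> * S2 * C1"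
proof -
  let ?X = "C2\<^sup>\<flat> * S2 * C1"
  \<comment> \<open>With the products named, the final comparison is linear in the entries of
    \<open>P\<close>, \<open>Q\<close>, \<open>X\<close>, \<open>X\<^sup>\<flat>\<close> and the two
    Hamiltonians.\<close>
  define P where "P = C1\<^sup>\<flat> * C1"
  define Q where "Q = C2\<^sup>\<flat> * C2"
  define X where "X = ?X"
  have c: "P \<in> carrier_mat (2 * m) (2 * m)" "Q \<in> carrier_mat (2 * m) (2 * m)"
    "X \<in> carrier_mat (2 * m) (2 * m)" "X\<^sup>\<flat> \<in> carrier_mat (2 * m) (2 * m)"
    using flat_carrier[OF coupling_carrier] by (simp_all add: P_def Q_def X_def)
  have unit: "(C1\<^sup>\<flat> * S2\<^sup>\<flat>) * (S2 * C1) = P"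
    unfolding P_def by (rule mult_mat_cancel_middle[OF _ _ _ _ L_BogD(2)[OF G2]]) (rule L_BogD[OF G1] L_BogD[OF G2])+
  have "(C2 + S2 * C1)\<^sup>\<flat> * (C2 + S2 * C1) =
      C2\<^sup>\<flat> * C2 + C1\<^sup>\<flat> * S2\<^sup>\<flat> * C2 + (C2\<^sup>\<flat> * (S2 * C1) + (C1\<^sup>\<flat> * S2\<^sup>\<flat>) * (S2 * C1))"
    by (simp add: flat_series_C add_mult_distrib_mat[of _ "2*m" "2*n" _ _ "2*m"]
        mult_add_distrib_mat[of _ "2*m" "2*n" _ "2*m"])
  also have "\<dots> = Q + X\<^sup>\<flat> + (X + P)"
    unfolding unit
    by (simp add: Q_def X_def flat_coupling assoc_mult_mat[of _ "2*m" "2*n" _ "2*n" _ "2*m", symmetric])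
  finally have CC: "(C2 + S2 * C1)\<^sup>\<flat> * (C2 + S2 * C1) = Q + X\<^sup>\<flat> + (X + P)" .
  show ?thesis
    unfolding CC joint_drift_def Im_flat_def prod.case P_def[symmetric] Q_def[symmetric] X_def[symmetric]
    using c L_BogD(5)[OF G1] L_BogD(5)[OF G2]
    by (intro eq_matI) (auto simp: field_simps)
qed

text \<open>Unitarity of \<open>S2\<close> removes it from the part coming from \<open>C1\<close>;
  the part coming from \<open>C2\<close> keeps it.\<close>

lemma series_input:
  "(C2 + S2 * C1)\<^sup>\<flat> * (S2 * S1) = (C2\<^sup>\<flat> * S2 + C1\<^sup>\<flat>) * S1"
proof -
  have "(C1\<^sup>\<flat> * S2\<^sup>\<flat>) * (S2 * S1) = C1\<^sup>\<flat> * S1"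
    by (rule mult_mat_cancel_middle[OF _ _ _ _ L_BogD(2)[OF G2]]) (rule L_BogD[OF G1] L_BogD[OF G2])+
  then show ?thesis
    by (simp add: flat_series_C add_mult_distrib_mat[of _ "2*m" "2*n" _ _ "2*n"]
        assoc_mult_mat[of _ "2*m" "2*n" _ "2*n" _ "2*n"])
qed

end

section \<open>Elimination of the internal fields\<close>

context star_space
begin

text \<open>Substitutes the output equation of one system into an input of another.\<close>

lemma act_output:
  assumes "Y \<in> carrier_mat r k" "C \<in> carrier_mat k p" "S \<in> carrier_mat k q"
  shows "act scale Y (act scale C x + act scale S y) =
    act scale (Y * C) x + act scale (Y * S) y"
  using assms by (simp add: act_add_right[of _ r k] act_carrier act_act[of _ r k])

text \<open>The first output equation fixes the doubled-up form of both internal fields, so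
  eliminating them is a substitution. The sizes of \<open>a\<close> and \<open>b1\<close> enter
  through \<open>breve_of_output\<close>, by which such fields exist.\<close>

lemma series_eqs_iff:
  assumes G1: "(S1, C1, \<Omega>1) \<in> L_Bog n m" and G2: "(S2, C2, \<Omega>2) \<in> L_Bog n m"
    and a: "a \<in> carrier_vec m" and b1: "b1 \<in> carrier_vec n"
  shows "series_eqs scale star n (S2, C2, \<Omega>2) (S1, C1, \<Omega>1) a' a b1 b_out2 \<longleftrightarrow>
    breve star a' = act scale (joint_drift (S1, C1, \<Omega>1) (S2, C2, \<Omega>2) - C2\<^sup>\<flat> * S2 * C1) (breve star a)
      - act scale ((C2\<^sup>\<flat> * S2 + C1\<^sup>\<flat>) * S1) (breve star b1) \<and>
    breve star b_out2 = act scale (C2 + S2 * C1) (breve star a) + act scale (S2 * S1) (breve star b1)"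
proof -
  let ?w = "act scale C1 (breve star a) + act scale S1 (breve star b1)"
  let ?A = "joint_drift (S1, C1, \<Omega>1) (S2, C2, \<Omega>2)"
  note c = L_BogD(5,8-)[OF G1] L_BogD(5,8-)[OF G2]
  note c' = product_carriers[OF G1 G2] coupling_carrier[OF G1 G2]
  have A: "?A \<in> carrier_mat (2 * m) (2 * m)"
    using c c' by (simp add: joint_drift_def minus_carrier_mat)
  have drift: "act scale ?A (breve star a) - act scale (C1\<^sup>\<flat> * S1) (breve star b1)
        - act scale (C2\<^sup>\<flat> * S2) ?w =
      act scale (?A - C2\<^sup>\<flat> * S2 * C1) (breve star a)
        - act scale ((C2\<^sup>\<flat> * S2 + C1\<^sup>\<flat>) * S1) (breve star b1)"
  proof -
    have "(C2\<^sup>\<flat> * S2 + C1\<^sup>\<flat>) * S1 = C2\<^sup>\<flat> * S2 * S1 + C1\<^sup>\<flat> * S1"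
      using c c' by (simp add: add_mult_distrib_mat[of _ "2*m" "2*n"])
    moreover have "act scale (C2\<^sup>\<flat> * S2) ?w = act scale (C2\<^sup>\<flat> * S2 * C1) (breve star a)
        + act scale (C2\<^sup>\<flat> * S2 * S1) (breve star b1)"
      using c c' by (intro act_output)
    \<comment> \<open>Vectors of arbitrary length form no group, so the rearrangement is checked
      entrywise at length \<open>2 * m\<close>.\<close>
    moreover have regroup: "u - w - (v + z) = (u - v) - (z + w)"
      if "u \<in> carrier_vec (2 * m)" "v \<in> carrier_vec (2 * m)" "w \<in> carrier_vec (2 * m)"
        "z \<in> carrier_vec (2 * m)" for u v w z :: "'v vec"
      using that by (intro eq_vecI) auto
    ultimately show ?thesis
      using A c' regroup[OF act_carrier[OF A] act_carrier[OF c'(9)] act_carrier[OF c'(5)]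
          act_carrier[OF c'(8)]]
      by (simp add: act_add_left[of _ "2*m" "2*n"] act_diff_left[of _ "2*m" "2*m"])
  qed
  have out: "act scale C2 (breve star a) + act scale S2 ?w =
      act scale (C2 + S2 * C1) (breve star a) + act scale (S2 * S1) (breve star b1)"
    using c c' by (simp add: act_output[of _ "2*n" "2*n" _ "2*m" _ "2*n"]
        act_add_left[of _ "2*n" "2*m"]
        assoc_add_vec[OF act_carrier[OF c(8)] act_carrier[OF c'(2)] act_carrier[OF c'(1)]])
  \<comment> \<open>The witness for both \<open>b2\<close> and \<open>b_out1\<close>.\<close>
  obtain z where "z \<in> carrier_vec n" "breve star z = ?w"
    using breve_of_output[OF L_BogD(4)[OF G1] L_BogD(1)[OF G1] a b1] .
  then have "series_eqs scale star n (S2, C2, \<Omega>2) (S1, C1, \<Omega>1) a' a b1 b_out2 \<longleftrightarrow>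
    breve star a' = act scale ?A (breve star a) - act scale (C1\<^sup>\<flat> * S1) (breve star b1)
      - act scale (C2\<^sup>\<flat> * S2) ?w \<and>
    breve star b_out2 = act scale C2 (breve star a) + act scale S2 ?w"
    unfolding series_eqs_def joint_eqs_def prod.case by metis
  then show ?thesis unfolding drift out .
qed

end

text \<open>In a small space of operators, such as the zero space, the equations do not determine
  their coefficient matrices; hence the two matrix identities are asserted beside the
  equivalences.\<close>

theorem mainTheorem5:
  fixes scale :: "complex \<Rightarrow> 'v::ab_group_add \<Rightarrow> 'v" and star :: "'v \<Rightarrow> 'v"
    and n m :: nat
    and S1 C1 \<Omega>1 S2 C2 \<Omega>2 S C \<Omega> A :: "complex mat"
  assumes "star_space scale star"
    and G1: "(S1, C1, \<Omega>1) \<in> L_Bog n m"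
    and G2: "(S2, C2, \<Omega>2) \<in> L_Bog n m"
    and S: "S = S2 * S1"
    and C: "C = C2 + S2 * C1"
    and \<Omega>: "\<Omega> = \<Omega>1 + \<Omega>2 + Im_flat (C2\<^sup>\<flat> * S2 * C1)"
    and A: "A = joint_drift (S1, C1, \<Omega>1) (S2, C2, \<Omega>2)"
  shows "(S, C, \<Omega>) \<in> L_Bog n m \<and>
    (- 1/2) \<cdot>\<^sub>m (C\<^sup>\<flat> * C) - \<i> \<cdot>\<^sub>m \<Omega> = A - C2\<^sup>\<flat> * S2 * C1 \<and>
    C\<^sup>\<flat> * S = (C2\<^sup>\<flat> * S2 + C1\<^sup>\<flat>) * S1 \<and>
    (\<forall>a' \<in> carrier_vec m. \<forall>a \<in> carrier_vec m. \<forall>b1 \<in> carrier_vec n. \<forall>b_out2 \<in> carrier_vec n.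
      (series_eqs scale star n (S2, C2, \<Omega>2) (S1, C1, \<Omega>1) a' a b1 b_out2 \<longleftrightarrow>
         system_eqs scale star (S, C, \<Omega>) a' a b1 b_out2) \<and>
      (system_eqs scale star (S, C, \<Omega>) a' a b1 b_out2 \<longleftrightarrow>
         breve star a' = act scale (A - C2\<^sup>\<flat> * S2 * C1) (breve star a)
                         - act scale ((C2\<^sup>\<flat> * S2 + C1\<^sup>\<flat>) * S1) (breve star b1) \<and>
         breve star b_out2 = act scale (C2 + S2 * C1) (breve star a)
                             + act scale (S2 * S1) (breve star b1)))"
proof -
  interpret star_space scale star by fact
  note drift = series_drift[OF G1 G2] and input = series_input[OF G1 G2]
  \<comment> \<open>After rewriting with the drift and input identities, the equations of the triple
    are literally the reduced ones.\<close>
  have sys: "system_eqs scale star (S, C, \<Omega>) a' a b1 b_out2 \<longleftrightarrow>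
      breve star a' = act scale (A - C2\<^sup>\<flat> * S2 * C1) (breve star a)
                      - act scale ((C2\<^sup>\<flat> * S2 + C1\<^sup>\<flat>) * S1) (breve star b1) \<and>
      breve star b_out2 = act scale (C2 + S2 * C1) (breve star a)
                          + act scale (S2 * S1) (breve star b1)" for a' a b1 b_out2
    unfolding system_eqs_def prod.case S C \<Omega> A drift input by (rule refl)
  moreover have "series_eqs scale star n (S2, C2, \<Omega>2) (S1, C1, \<Omega>1) a' a b1 b_out2 \<longleftrightarrow>
      system_eqs scale star (S, C, \<Omega>) a' a b1 b_out2"
    if "a \<in> carrier_vec m" "b1 \<in> carrier_vec n" for a' a b1 b_out2
    unfolding sys A by (rule series_eqs_iff[OF G1 G2 that])
  moreover have "(S, C, \<Omega>) \<in> L_Bog n m"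
    unfolding S C \<Omega> by (rule series_in_L_Bog[OF G1 G2])
  moreover have "(- 1/2) \<cdot>\<^sub>m (C\<^sup>\<flat> * C) - \<i> \<cdot>\<^sub>m \<Omega> = A - C2\<^sup>\<flat> * S2 * C1"
    unfolding C \<Omega> A by (rule drift)
  moreover have "C\<^sup>\<flat> * S = (C2\<^sup>\<flat> * S2 + C1\<^sup>\<flat>) * S1"
    unfolding C S by (rule input)
  ultimately show ?thesis
    by (intro conjI ballI)
qed

end
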